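(* Let $C_n,D_n\in\mathcal F$ be almost surely convergent sequences of sets, i.e., $\operatorname{as-lim}_n C_n=C$ and $\operatorname{as-lim}_n D_n=D$. Then: (a) $\operatorname{as-lim}_n (C_n\cup D_n)=C\cup D$; (b) $\operatorname{as-lim\,sup}_n (C_n\cap D_n)\subseteq C\cap D$; (c) $\operatorname{as-lim\,inf}_n \mathrm{cl}(C_n^{\mathsf c})\supseteq \mathrm{cl}(C^{\mathsf c})$; (d) $\operatorname{as-lim\,inf}_n \partial C_n\supseteq\partial C$; (e) $\operatorname{as-lim\,inf}_n \mathrm{co}(C_n)\supseteq\mathrm{co}(C)$; (f) $\operatorname{as-lim}_n \mathrm{co}(C_n)=\mathrm{co}(C)$, when there is a deterministic $C_0\in\mathcal K$ such that $C_n\subseteq C_0$ almost surely.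
   Context: $(\Omega,\mathfrak F,\mathbb P)$ is a complete probability space; $\mathcal F$ and $\mathcal K$ are the spaces of closed and compact subsets of a Euclidean space $E$; $C_n,D_n$ are random sets (maps $\Omega\to\mathcal F$ measurable for the Borel $\sigma$-algebra on $\mathcal F$). $\mathrm{cl}$ is closure, $C^{\mathsf c}$ complement, $\partial C$ boundary, $\mathrm{co}$ convex hull. Set limits: $\limsup_n C_n = \{x : \exists n_k \text{ s.t. } x_{n_k}\to x \text{ with } x_{n_k}\in C_{n_k}\}$, $\liminf_n C_n = \{x : \exists x_n\to x \text{ with } x_n\in C_n\}$, and $\lim_n C_n$ exists when these are equal, in which case it is their common value. $\operatorname{as-lim\,sup}_n C_n\subseteq C$ means $\mathbb P(\limsup_n C_n\subseteq C)=1$; $\operatorname{as-lim\,inf}_n C_n\supseteq C$ means $\mathbb P(\liminf_n C_n\supseteq C)=1$; $\operatorname{as-lim}_n C_n=C$ means $\mathbb P(\lim_n C_n=C)=1$. *)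

theory Defs
  imports "HOL-Probability.Probability"
begin

section \<open>Painleve--Kuratowski limits of sequences of sets\<close>

definition set_limsup :: "(nat \<Rightarrow> 'e::topological_space set) \<Rightarrow> 'e set" where
  "set_limsup A = {x. \<exists>r y. strict_mono (r :: nat \<Rightarrow> nat) \<and> (\<forall>k. y k \<in> A (r k)) \<and> y \<longlonglongrightarrow> x}"

text \<open>
  Membership is only required from some index on, as usual for lower limits.  Sets in the
  sequence may be empty, and demanding it for every index would make the lower limit empty
  as soon as one set is, so that changing a single set could change the limit.
\<close>

definition set_liminf :: "(nat \<Rightarrow> 'e::topological_space set) \<Rightarrow> 'e set" where
  "set_liminf A = {x. \<exists>y. (\<forall>\<^sub>F n in sequentially. y n \<in> A n) \<and> y \<longlonglongrightarrow> x}"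

definition set_lim :: "(nat \<Rightarrow> 'e::topological_space set) \<Rightarrow> 'e set \<Rightarrow> bool" where
  "set_lim A L \<longleftrightarrow> set_liminf A = L \<and> set_limsup A = L"

section \<open>Random closed sets\<close>

text \<open>
  The space of closed sets carries the Fell (hit-or-miss) topology, which for closed subsets
  of a Euclidean space is the topology of Painleve--Kuratowski convergence.
\<close>

definition fell_topology :: "'e::topological_space set topology" where
  "fell_topology = topology_generated_by
     ({{F. closed F \<and> F \<inter> K = {}} | K. compact K} \<union>
      {{F. closed F \<and> F \<inter> G \<noteq> {}} | G. open G})"

lemma topspace_fell_topology: "topspace fell_topology = {F. closed F}"
  unfolding fell_topology_def topology_generated_by_topspace
proof (rule subset_antisym)
  show "{F :: 'a set. closed F} \<subseteq> \<Union>({{F. closed F \<and> F \<inter> K = {}} | K. compact K} \<union>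
      {{F. closed F \<and> F \<inter> G \<noteq> {}} | G. open G})"
    by (rule Union_upper, rule UnI1, rule CollectI, rule exI[of _ "{}"]) simp
qed auto

definition fell_borel :: "'e::topological_space set measure" where
  "fell_borel = sigma (topspace fell_topology) {U. openin fell_topology U}"

lemma openin_fell_subset: "{U. openin fell_topology U} \<subseteq> Pow (topspace fell_topology)"
  using openin_subset by (intro subsetI) simp

lemma space_fell_borel: "space fell_borel = {F. closed F}"
  using space_measure_of[OF openin_fell_subset] unfolding fell_borel_def topspace_fell_topology .

lemma sets_fell_borel:
  "sets fell_borel = sigma_sets {F. closed F} {U. openin fell_topology U}"
  using sets_measure_of[OF openin_fell_subset] unfolding fell_borel_def topspace_fell_topology .

definition random_closed_set :: "'w measure \<Rightarrow> ('w \<Rightarrow> 'e::topological_space set) \<Rightarrow> bool" where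
  "random_closed_set M X \<longleftrightarrow> X \<in> M \<rightarrow>\<^sub>M fell_borel"

section \<open>Almost sure limits\<close>

text \<open>
  The bounding set may depend on the outcome; a deterministic one is a constant function.
  Since \<^const>\<open>measure\<close> is 0 on nonmeasurable sets, each definition entails that
  the event in question is measurable.
\<close>

definition as_limsup_subset ::
  "'w measure \<Rightarrow> (nat \<Rightarrow> 'w \<Rightarrow> 'e::topological_space set) \<Rightarrow> ('w \<Rightarrow> 'e set) \<Rightarrow> bool" where
  "as_limsup_subset M X L \<longleftrightarrow>
     measure M {\<omega> \<in> space M. set_limsup (\<lambda>n. X n \<omega>) \<subseteq> L \<omega>} = 1"

definition as_liminf_supset ::
  "'w measure \<Rightarrow> (nat \<Rightarrow> 'w \<Rightarrow> 'e::topological_space set) \<Rightarrow> ('w \<Rightarrow> 'e set) \<Rightarrow> bool" where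
  "as_liminf_supset M X L \<longleftrightarrow>
     measure M {\<omega> \<in> space M. set_liminf (\<lambda>n. X n \<omega>) \<supseteq> L \<omega>} = 1"

definition as_lim ::
  "'w measure \<Rightarrow> (nat \<Rightarrow> 'w \<Rightarrow> 'e::topological_space set) \<Rightarrow> ('w \<Rightarrow> 'e set) \<Rightarrow> bool" where
  "as_lim M X L \<longleftrightarrow>
     measure M {\<omega> \<in> space M. set_lim (\<lambda>n. X n \<omega>) (L \<omega>)} = 1"

end

theory Submission
  imports Defs
begin

text \<open>
  On a complete probability space an event of probability one is the same as an almost sure
  property, measurable or not, so each claim reduces to deterministic sequences of sets.
  For the frontiers, a ball around a point of \<^term>\<open>frontier L\<close> eventually meets both
  \<^term>\<open>A n\<close> and its complement, hence, being connected, its frontier.  For the hulls, the lower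
  limit of convex sets is convex, which gives one inclusion; if the sets stay in a compact set,
  then by compactness they eventually lie in any open neighbourhood \<open>L + ball 0 \<epsilon>\<close> of the limit,
  so their hulls lie in the convex set \<open>convex hull L + ball 0 \<epsilon>\<close>, and \<open>convex hull L\<close> is
  compact, hence closed.
\<close>

section \<open>Lower and upper limits of sequences of sets\<close>

lemma set_liminfI:
  "\<forall>\<^sub>F n in sequentially. y n \<in> A n \<Longrightarrow> y \<longlonglongrightarrow> x \<Longrightarrow> x \<in> set_liminf A"
  unfolding set_liminf_def by auto

lemma set_limsupI:
  "strict_mono r \<Longrightarrow> (\<And>k. y k \<in> A (r k)) \<Longrightarrow> y \<longlonglongrightarrow> x \<Longrightarrow> x \<in> set_limsup A"
  unfolding set_limsup_def by auto

text \<open>From right to left, approximations at each scale \<open>e\<close> must be merged into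
  one sequence. Choosing in each \<open>A n\<close> a point whose distance to \<open>x\<close> is
  almost minimal serves all \<open>e\<close> at once.\<close>

lemma set_liminf_iff:
  fixes x :: "'e::metric_space"
  shows "x \<in> set_liminf A \<longleftrightarrow> (\<forall>e>0. \<forall>\<^sub>F n in sequentially. \<exists>y\<in>A n. dist y x < e)"
proof
  assume "x \<in> set_liminf A"
  then obtain y where y: "\<forall>\<^sub>F n in sequentially. y n \<in> A n" and lim: "y \<longlonglongrightarrow> x"
    unfolding set_liminf_def by blast
  show "\<forall>e>0. \<forall>\<^sub>F n in sequentially. \<exists>y\<in>A n. dist y x < e"
  proof (intro allI impI)
    fix e :: real
    assume "e > 0"
    from tendstoD[OF lim this] y show "\<forall>\<^sub>F n in sequentially. \<exists>y\<in>A n. dist y x < e"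
      by eventually_elim blast
  qed
next
  assume near: "\<forall>e>0. \<forall>\<^sub>F n in sequentially. \<exists>y\<in>A n. dist y x < e"
  \<comment> \<open>The sets need not be closed, so the infimum distance may not be attained; the
    vanishing slack \<open>inverse (real (Suc n))\<close> replaces a nearest point.\<close>
  have "\<exists>y. A n \<noteq> {} \<longrightarrow> y \<in> A n \<and> dist x y < infdist x (A n) + inverse (real (Suc n))" for n
  proof (cases "A n = {}")
    case False
    have "(INF a\<in>A n. dist x a) < infdist x (A n) + inverse (real (Suc n))"
      using False by (simp add: infdist_notempty)
    then show ?thesis
      using False by (subst (asm) cINF_less_iff) auto
  qed simp
  then obtain y where y: "\<And>n. A n \<noteq> {} \<Longrightarrow> y n \<in> A n"
    and dist_y: "\<And>n. A n \<noteq> {} \<Longrightarrow> dist x (y n) < infdist x (A n) + inverse (real (Suc n))"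
    by metis
  \<comment> \<open>Any positive radius would do: the aim is that \<open>A n\<close> is eventually
    nonempty.\<close>
  have "\<forall>\<^sub>F n in sequentially. \<exists>y\<in>A n. dist y x < 1"
    using near by simp
  then have "\<forall>\<^sub>F n in sequentially. y n \<in> A n"
    by eventually_elim (use y in blast)
  moreover have "y \<longlonglongrightarrow> x"
  proof (rule tendstoI)
    fix e :: real
    assume "e > 0"
    then have "\<forall>\<^sub>F n in sequentially. \<exists>y\<in>A n. dist y x < e / 2"
      using near half_gt_zero by blast
    moreover have "\<forall>\<^sub>F n in sequentially. inverse (real (Suc n)) < e / 2"
      using order_tendstoD(2)[OF LIMSEQ_inverse_real_of_nat, of "e / 2"] \<open>e > 0\<close> by simp
    ultimately show "\<forall>\<^sub>F n in sequentially. dist (y n) x < e"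
    proof eventually_elim
      case (elim n)
      then obtain a where a: "a \<in> A n" "dist a x < e / 2"
        by blast
      have "infdist x (A n) \<le> dist a x"
        using infdist_le[OF a(1), of x] by (simp add: dist_commute)
      moreover have "A n \<noteq> {}"
        using a(1) by blast
      ultimately show ?case
        using dist_y[of n] a(2) elim(2) by (simp add: dist_commute)
    qed
  qed
  ultimately show "x \<in> set_liminf A"
    by (rule set_liminfI)
qed

lemma set_liminf_mono:
  assumes "\<And>n. A n \<subseteq> B n"
  shows "set_liminf A \<subseteq> set_liminf B"
proof
  fix x
  assume "x \<in> set_liminf A"
  then obtain y where y: "\<forall>\<^sub>F n in sequentially. y n \<in> A n" "y \<longlonglongrightarrow> x"
    unfolding set_liminf_def by blast
  have "\<forall>\<^sub>F n in sequentially. y n \<in> B n"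
    using y(1) by (rule eventually_mono) (rule subsetD[OF assms])
  then show "x \<in> set_liminf B"
    using y(2) by (rule set_liminfI)
qed

lemma set_limsup_mono: "(\<And>n. A n \<subseteq> B n) \<Longrightarrow> set_limsup A \<subseteq> set_limsup B"
  unfolding set_limsup_def by blast

lemma closed_set_liminf:
  fixes A :: "nat \<Rightarrow> 'e::metric_space set"
  shows "closed (set_liminf A)"
  unfolding closed_sequential_limits
proof (intro allI impI, elim conjE)
  fix z x
  assume z: "\<forall>k. z k \<in> set_liminf A" and lim: "z \<longlonglongrightarrow> x"
  show "x \<in> set_liminf A"
    unfolding set_liminf_iff
  proof (intro allI impI)
    fix e :: real
    assume "e > 0"
    then have "\<forall>\<^sub>F k in sequentially. dist (z k) x < e / 2"
      using tendstoD[OF lim, of "e / 2"] by simp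
    then obtain k where k: "dist (z k) x < e / 2"
      by (metis eventually_happens sequentially_bot)
    have "\<forall>\<^sub>F n in sequentially. \<exists>y\<in>A n. dist y (z k) < e / 2"
      using z \<open>e > 0\<close> half_gt_zero unfolding set_liminf_iff by blast
    then show "\<forall>\<^sub>F n in sequentially. \<exists>y\<in>A n. dist y x < e"
    proof eventually_elim
      case (elim n)
      then obtain y where "y \<in> A n" "dist y (z k) < e / 2"
        by blast
      then show ?case
        using k dist_triangle[of y x "z k"] by force
    qed
  qed
qed

lemma frequently_sequentially_subseq:
  assumes "\<exists>\<^sub>F n in sequentially. P n"
  obtains r :: "nat \<Rightarrow> nat" where "strict_mono r" "\<And>k. P (r k)"
proof -
  have "infinite {n. P n}"
    using assms by (simp add: frequently_cofinite flip: cofinite_eq_sequentially)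
  then show ?thesis
    using infinite_enumerate that by blast
qed

lemma set_liminf_subset_limsup: "set_liminf A \<subseteq> set_limsup A"
proof
  fix x
  assume "x \<in> set_liminf A"
  then obtain y N where y: "\<And>n. n \<ge> N \<Longrightarrow> y n \<in> A n" and lim: "y \<longlonglongrightarrow> x"
    unfolding set_liminf_def eventually_sequentially by blast
  \<comment> \<open>The upper limit demands membership for every \<open>k\<close>, so the first
    \<open>N\<close> indices are shifted away.\<close>
  have "strict_mono (\<lambda>k. k + N)"
    by (simp add: strict_mono_def)
  moreover have "(\<lambda>k. y (k + N)) \<longlonglongrightarrow> x"
    using lim by (rule LIMSEQ_ignore_initial_segment)
  ultimately show "x \<in> set_limsup A"
    by (intro set_limsupI[of "\<lambda>k. k + N" "\<lambda>k. y (k + N)"]) (simp_all add: y)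
qed

text \<open>The inclusions close up the chain from \<open>L\<close> through the lower and the upper
  limit back to \<open>L\<close>.\<close>

lemma set_limI: "L \<subseteq> set_liminf A \<Longrightarrow> set_limsup A \<subseteq> L \<Longrightarrow> set_lim A L"
  using set_liminf_subset_limsup[of A] unfolding set_lim_def by blast

text \<open>Infinitely many good indices suffice, since a further subsequence \<open>s\<close> runs
  through good ones alone.\<close>

lemma set_limsup_frequentlyI:
  assumes "\<exists>\<^sub>F k in sequentially. y k \<in> A (r k)" "strict_mono r" "y \<longlonglongrightarrow> x"
  shows "x \<in> set_limsup A"
proof -
  obtain s :: "nat \<Rightarrow> nat" where s: "strict_mono s" "\<And>k. y (s k) \<in> A (r (s k))"
    using frequently_sequentially_subseq[OF assms(1)] by blast
  then show ?thesis
    using strict_mono_o[OF assms(2) s(1)] LIMSEQ_subseq_LIMSEQ[OF assms(3) s(1)]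
    by (intro set_limsupI[of "r \<circ> s" "y \<circ> s"]) simp_all
qed

section \<open>Unions\<close>

lemma set_limsup_Un: "set_limsup (\<lambda>n. A n \<union> B n) = set_limsup A \<union> set_limsup B"
proof
  show "set_limsup (\<lambda>n. A n \<union> B n) \<subseteq> set_limsup A \<union> set_limsup B"
  proof
    fix x
    assume "x \<in> set_limsup (\<lambda>n. A n \<union> B n)"
    then obtain r :: "nat \<Rightarrow> nat" and y where ry: "strict_mono r" "y \<longlonglongrightarrow> x"
      and "\<And>k. y k \<in> A (r k) \<union> B (r k)"
      unfolding set_limsup_def by blast
    \<comment> \<open>Membership for all \<open>k\<close> is weakened to infinitely many
      \<open>k\<close> because \<open>frequently\<close>, unlike a universal quantifier, distributes
      over a disjunction: one of the two sets is hit infinitely often.\<close>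
    then have "\<exists>\<^sub>F k in sequentially. y k \<in> A (r k) \<or> y k \<in> B (r k)"
      by (simp add: frequently_const_iff)
    then show "x \<in> set_limsup A \<union> set_limsup B"
      unfolding frequently_disj_iff using ry set_limsup_frequentlyI by blast
  qed
qed (simp add: set_limsup_mono)

lemma set_lim_Un:
  assumes "set_lim A K" "set_lim B L"
  shows "set_lim (\<lambda>n. A n \<union> B n) (K \<union> L)"
proof (rule set_limI)
  show "K \<union> L \<subseteq> set_liminf (\<lambda>n. A n \<union> B n)"
    using assms set_liminf_mono[of A "\<lambda>n. A n \<union> B n"] set_liminf_mono[of B "\<lambda>n. A n \<union> B n"]
    unfolding set_lim_def by blast
qed (use assms in \<open>simp add: set_limsup_Un set_lim_def\<close>)

section \<open>Complements and frontiers\<close>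

text \<open>A point lying in infinitely many \<open>A n\<close> is in the upper limit, by a constant
  sequence. So a point outside \<open>L\<close> eventually lies in \<open>- A n\<close>, and the
  same constant sequence puts it in the lower limit; closedness of lower limits takes care of the
  closure.\<close>

lemma closure_Compl_subset_set_liminf:
  fixes A :: "nat \<Rightarrow> 'e::metric_space set"
  assumes "set_limsup A \<subseteq> L"
  shows "closure (- L) \<subseteq> set_liminf (\<lambda>n. - A n)"
proof (rule closure_minimal[OF _ closed_set_liminf], rule subsetI)
  fix x
  assume "x \<in> - L"
  then have "\<not> (\<exists>\<^sub>F k in sequentially. x \<in> A k)"
    using assms set_limsup_frequentlyI[of "\<lambda>_. x" A id x] by (auto simp: strict_mono_id)
  then show "x \<in> set_liminf (\<lambda>n. - A n)"
    unfolding not_frequently by (intro set_liminfI[of "\<lambda>_. x"]) simp_all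
qed

lemma frontier_subset_set_liminf:
  fixes A :: "nat \<Rightarrow> 'e::real_normed_vector set"
  assumes "set_lim A L"
  shows "frontier L \<subseteq> set_liminf (\<lambda>n. frontier (A n))"
proof
  fix x
  assume "x \<in> frontier L"
  then have "x \<in> closure L" "x \<in> closure (- L)"
    by (simp_all add: frontier_closures)
  moreover have lim: "set_liminf A = L" "set_limsup A = L"
    using assms by (simp_all add: set_lim_def)
  \<comment> \<open>Being a lower limit, \<open>L\<close> is closed, so
    \<open>x \<in> closure L\<close> already means \<open>x \<in> set_liminf A\<close>.\<close>
  moreover have "closed L"
    using closed_set_liminf[of A] unfolding lim .
  ultimately have x: "x \<in> set_liminf A" "x \<in> set_liminf (\<lambda>n. - A n)"
    using closure_Compl_subset_set_liminf[of A L] by (simp, blast)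
  show "x \<in> set_liminf (\<lambda>n. frontier (A n))"
    unfolding set_liminf_iff
  proof (intro allI impI)
    fix e :: real
    assume "e > 0"
    then have "\<forall>\<^sub>F n in sequentially. \<exists>y\<in>A n. dist y x < e"
      "\<forall>\<^sub>F n in sequentially. \<exists>y\<in>- A n. dist y x < e"
      using x unfolding set_liminf_iff by blast+
    then show "\<forall>\<^sub>F n in sequentially. \<exists>y\<in>frontier (A n). dist y x < e"
    proof eventually_elim
      case (elim n)
      then obtain a b where "a \<in> ball x e \<inter> A n" "b \<in> ball x e - A n"
        by (auto simp: dist_commute)
      then have "ball x e \<inter> A n \<noteq> {}" "ball x e - A n \<noteq> {}"
        by blast+
      then have "ball x e \<inter> frontier (A n) \<noteq> {}"
        by (intro connected_Int_frontier connected_ball)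
      then show ?case
        by (auto simp: dist_commute)
    qed
  qed
qed

section \<open>Convex hulls\<close>

lemma convex_set_liminf:
  fixes A :: "nat \<Rightarrow> 'e::real_normed_vector set"
  assumes "\<And>n. convex (A n)"
  shows "convex (set_liminf A)"
proof (rule convexI)
  fix x y :: 'e and u v :: real
  assume "x \<in> set_liminf A" "y \<in> set_liminf A" and uv: "0 \<le> u" "0 \<le> v" "u + v = 1"
  then obtain a b where a: "\<forall>\<^sub>F n in sequentially. a n \<in> A n" "a \<longlonglongrightarrow> x"
    and b: "\<forall>\<^sub>F n in sequentially. b n \<in> A n" "b \<longlonglongrightarrow> y"
    unfolding set_liminf_def by blast
  have "\<forall>\<^sub>F n in sequentially. u *\<^sub>R a n + v *\<^sub>R b n \<in> A n"
    using a(1) b(1) by eventually_elim (use convexD[OF assms] uv in blast)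
  moreover have "(\<lambda>n. u *\<^sub>R a n + v *\<^sub>R b n) \<longlonglongrightarrow> u *\<^sub>R x + v *\<^sub>R y"
    by (intro tendsto_intros a b)
  ultimately show "u *\<^sub>R x + v *\<^sub>R y \<in> set_liminf A"
    by (rule set_liminfI)
qed

lemma convex_hull_subset_set_liminf:
  fixes A :: "nat \<Rightarrow> 'e::real_normed_vector set"
  assumes "L \<subseteq> set_liminf A"
  shows "convex hull L \<subseteq> set_liminf (\<lambda>n. convex hull (A n))"
proof (rule hull_minimal)
  show "L \<subseteq> set_liminf (\<lambda>n. convex hull (A n))"
    by (rule subset_trans[OF assms set_liminf_mono[OF hull_subset]])
qed (simp add: convex_set_liminf)

text \<open>Otherwise points of \<open>A n\<close> outside \<open>U\<close> exist along a
  subsequence. They accumulate in the compact set \<open>K - U\<close>, and the accumulation point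
  belongs to the upper limit, hence to \<open>U\<close>.\<close>

lemma eventually_subset_open_if_bounded:
  fixes A :: "nat \<Rightarrow> 'e::metric_space set"
  assumes "set_limsup A \<subseteq> U" "open U" "compact K" "\<And>n. A n \<subseteq> K"
  shows "\<forall>\<^sub>F n in sequentially. A n \<subseteq> U"
proof (rule ccontr)
  assume "\<not> (\<forall>\<^sub>F n in sequentially. A n \<subseteq> U)"
  then have "\<exists>\<^sub>F n in sequentially. \<not> A n \<subseteq> U"
    by (simp add: not_eventually)
  then obtain r :: "nat \<Rightarrow> nat" where r: "strict_mono r" "\<And>k. \<not> A (r k) \<subseteq> U"
    using frequently_sequentially_subseq by blast
  then have "\<forall>k. \<exists>a. a \<in> A (r k) \<and> a \<notin> U"
    by blast
  then obtain y where y: "\<And>k. y k \<in> A (r k)" "\<And>k. y k \<notin> U"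
    by metis
  then have "\<forall>k. y k \<in> K - U"
    using assms(4) by blast
  moreover have "compact (K - U)"
    using assms(2,3) by (rule compact_diff[rotated])
  ultimately obtain x s where x: "x \<in> K - U" and s: "strict_mono (s :: nat \<Rightarrow> nat)"
    and lim: "(y \<circ> s) \<longlonglongrightarrow> x"
    unfolding compact_def by blast
  have "x \<in> set_limsup A"
    using strict_mono_o[OF r(1) s] _ lim by (rule set_limsupI) (simp add: y(1))
  then show False
    using x assms(1) by blast
qed

lemma set_limsup_convex_hull_subset:
  fixes A :: "nat \<Rightarrow> 'e::euclidean_space set"
  assumes "set_limsup A \<subseteq> L" "compact L" "compact K" "\<And>n. A n \<subseteq> K"
  shows "set_limsup (\<lambda>n. convex hull (A n)) \<subseteq> convex hull L"
proof
  fix x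
  assume "x \<in> set_limsup (\<lambda>n. convex hull (A n))"
  then obtain r y where r: "strict_mono r" and y: "\<And>k. y k \<in> convex hull (A (r k))"
    and lim: "y \<longlonglongrightarrow> x"
    unfolding set_limsup_def by blast
  have "\<exists>z\<in>convex hull L. dist z x < e" if "e > 0" for e
  proof -
    \<comment> \<open>\<open>U S\<close> is the Minkowski sum of \<open>S\<close> and a ball, with
      the other half of \<open>e\<close> left for \<open>dist (y k) x\<close>. It is a function of
      \<open>S\<close> because \<open>U L\<close> is needed for openness and
      \<open>U (convex hull L)\<close> for convexity.\<close>
    define U where "U = (\<lambda>S. \<Union>a\<in>S. \<Union>b\<in>ball (0::'e) (e / 2). {a + b})"
    have "open (U L)"
      unfolding U_def by (rule open_sums) simp
    moreover have "L \<subseteq> U L"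
      unfolding U_def using that by force
    ultimately have "\<forall>\<^sub>F n in sequentially. A n \<subseteq> U L"
      using assms by (intro eventually_subset_open_if_bounded[of A "U L" K]) auto
    then have "\<forall>\<^sub>F k in sequentially. A (r k) \<subseteq> U L"
      using eventually_subseq[OF r] by blast
    moreover have "\<forall>\<^sub>F k in sequentially. dist (y k) x < e / 2"
      using tendstoD[OF lim half_gt_zero[OF that]] .
    ultimately have "\<forall>\<^sub>F k in sequentially. \<exists>z\<in>convex hull L. dist z x < e"
    proof eventually_elim
      case (elim k)
      have "U L \<subseteq> U (convex hull L)"
        unfolding U_def using hull_subset[of L convex] by blast
      moreover have "convex (U (convex hull L))"
        unfolding U_def by (rule convex_sums) simp_all
      ultimately have "convex hull (A (r k)) \<subseteq> U (convex hull L)"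
        using elim(1) by (intro hull_minimal) blast+
      then obtain z b where "z \<in> convex hull L" "norm b < e / 2" "y k = z + b"
        using y[of k] unfolding U_def by auto
      moreover from this have "dist z x < e"
        using elim(2) dist_triangle[of z x "y k"] by (simp add: dist_norm)
      ultimately show ?case
        by blast
    qed
    then show ?thesis
      by simp
  qed
  then have "x \<in> closure (convex hull L)"
    by (simp add: closure_approachable)
  \<comment> \<open>Finite dimension enters here: the convex hull of a compact set is again
    compact.\<close>
  then show "x \<in> convex hull L"
    using compact_imp_closed[OF compact_convex_hull[OF assms(2)]] by simp
qed

lemma set_lim_convex_hull:
  fixes A :: "nat \<Rightarrow> 'e::euclidean_space set"
  assumes "set_lim A L" "compact K" "\<And>n. A n \<subseteq> K"
  shows "set_lim (\<lambda>n. convex hull (A n)) (convex hull L)"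
proof (rule set_limI)
  \<comment> \<open>Compactness of \<open>L\<close> uses both descriptions of it: as an upper limit
    it stays in the closed set \<open>K\<close>, as a lower limit it is closed.\<close>
  have "L \<subseteq> K"
  proof
    fix x
    assume "x \<in> L"
    then obtain y :: "nat \<Rightarrow> 'e" where "\<And>k. y k \<in> K" "y \<longlonglongrightarrow> x"
      using assms(1,3) unfolding set_lim_def set_limsup_def by blast
    then show "x \<in> K"
      using closed_sequentially[OF compact_imp_closed[OF assms(2)]] by blast
  qed
  moreover have "closed L"
    using assms(1) closed_set_liminf unfolding set_lim_def by blast
  ultimately have "compact L"
    using assms(2) compact_Int_closed[of K L] by (simp add: Int_absorb1)
  then show "set_limsup (\<lambda>n. convex hull (A n)) \<subseteq> convex hull L"
    using assms by (intro set_limsup_convex_hull_subset[OF _ _ assms(2,3)]) (simp_all add: set_lim_def)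
  show "convex hull L \<subseteq> set_liminf (\<lambda>n. convex hull (A n))"
    using assms(1) by (intro convex_hull_subset_set_liminf) (simp add: set_lim_def)
qed

section \<open>From almost sure to pointwise statements\<close>

text \<open>Forwards, measure 1 forces measurability, as \<open>measure\<close> vanishes on
  nonmeasurable sets. Backwards, the exceptional set is only known to lie in a null set;
  completeness makes it measurable. Thus no limit event needs its own measurability proof.\<close>

lemma complete_prob_eq_1_iff_AE:
  assumes "prob_space M" "complete_measure M"
  shows "measure M {\<omega>\<in>space M. P \<omega>} = 1 \<longleftrightarrow> (AE \<omega> in M. P \<omega>)"
proof -
  interpret prob_space M by fact
  interpret complete_measure M by fact
  show ?thesis
  proof
    assume eq: "prob {\<omega>\<in>space M. P \<omega>} = 1"
    then have "{\<omega>\<in>space M. P \<omega>} \<in> events"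
      by (metis measure_notin_sets zero_neq_one)
    with eq show "AE \<omega> in M. P \<omega>"
      using prob_Collect_eq_1 by blast
  next
    assume AE: "AE \<omega> in M. P \<omega>"
    then have "{\<omega>\<in>space M. \<not> P \<omega>} \<in> null_sets M"
      by (simp add: AE_iff_null_sets)
    then have "space M - {\<omega>\<in>space M. \<not> P \<omega>} \<in> events"
      by blast
    also have "space M - {\<omega>\<in>space M. \<not> P \<omega>} = {\<omega>\<in>space M. P \<omega>}"
      by blast
    finally show "prob {\<omega>\<in>space M. P \<omega>} = 1"
      using AE prob_Collect_eq_1 by blast
  qed
qed

theorem corollary1:
  fixes M :: "'w measure"
    and C D :: "nat \<Rightarrow> 'w \<Rightarrow> 'e::euclidean_space set"
    and C_lim D_lim :: "'w \<Rightarrow> 'e set"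
  assumes "prob_space M" and "complete_measure M"
    and "\<And>n. random_closed_set M (C n)" and "\<And>n. random_closed_set M (D n)"
    and "as_lim M C C_lim" and "as_lim M D D_lim"
  shows "as_lim M (\<lambda>n \<omega>. C n \<omega> \<union> D n \<omega>) (\<lambda>\<omega>. C_lim \<omega> \<union> D_lim \<omega>)
    \<and> as_limsup_subset M (\<lambda>n \<omega>. C n \<omega> \<inter> D n \<omega>) (\<lambda>\<omega>. C_lim \<omega> \<inter> D_lim \<omega>)
    \<and> as_liminf_supset M (\<lambda>n \<omega>. closure (- C n \<omega>)) (\<lambda>\<omega>. closure (- C_lim \<omega>))
    \<and> as_liminf_supset M (\<lambda>n \<omega>. frontier (C n \<omega>)) (\<lambda>\<omega>. frontier (C_lim \<omega>))
    \<and> as_liminf_supset M (\<lambda>n \<omega>. convex hull (C n \<omega>)) (\<lambda>\<omega>. convex hull (C_lim \<omega>))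
    \<and> ((\<exists>C0. compact C0 \<and> (\<forall>n. AE \<omega> in M. C n \<omega> \<subseteq> C0)) \<longrightarrow>
         as_lim M (\<lambda>n \<omega>. convex hull (C n \<omega>)) (\<lambda>\<omega>. convex hull (C_lim \<omega>)))"
proof -
  note AE_iff = complete_prob_eq_1_iff_AE[OF assms(1,2)]
  have C: "AE \<omega> in M. set_lim (\<lambda>n. C n \<omega>) (C_lim \<omega>)"
    and D: "AE \<omega> in M. set_lim (\<lambda>n. D n \<omega>) (D_lim \<omega>)"
    using assms(5,6) unfolding as_lim_def AE_iff by auto
  show ?thesis
    unfolding as_lim_def as_limsup_subset_def as_liminf_supset_def AE_iff
  proof (intro conjI impI)
    show "AE \<omega> in M. set_lim (\<lambda>n. C n \<omega> \<union> D n \<omega>) (C_lim \<omega> \<union> D_lim \<omega>)"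
      using C D by eventually_elim (rule set_lim_Un)
    show "AE \<omega> in M. set_limsup (\<lambda>n. C n \<omega> \<inter> D n \<omega>) \<subseteq> C_lim \<omega> \<inter> D_lim \<omega>"
      using C D
    proof eventually_elim
      case (elim \<omega>)
      then show ?case
        using set_limsup_mono[of "\<lambda>n. C n \<omega> \<inter> D n \<omega>" "\<lambda>n. C n \<omega>"]
          set_limsup_mono[of "\<lambda>n. C n \<omega> \<inter> D n \<omega>" "\<lambda>n. D n \<omega>"]
        by (simp add: set_lim_def)
    qed
    show "AE \<omega> in M. closure (- C_lim \<omega>) \<subseteq> set_liminf (\<lambda>n. closure (- C n \<omega>))"
      using C
    proof eventually_elim
      case (elim \<omega>)
      then have "closure (- C_lim \<omega>) \<subseteq> set_liminf (\<lambda>n. - C n \<omega>)"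
        by (intro closure_Compl_subset_set_liminf) (simp add: set_lim_def)
      also have "\<dots> \<subseteq> set_liminf (\<lambda>n. closure (- C n \<omega>))"
        by (intro set_liminf_mono closure_subset)
      finally show ?case .
    qed
    show "AE \<omega> in M. frontier (C_lim \<omega>) \<subseteq> set_liminf (\<lambda>n. frontier (C n \<omega>))"
      using C by eventually_elim (rule frontier_subset_set_liminf)
    show "AE \<omega> in M. convex hull (C_lim \<omega>) \<subseteq> set_liminf (\<lambda>n. convex hull (C n \<omega>))"
      using C by eventually_elim (simp add: convex_hull_subset_set_liminf set_lim_def)
  next
    assume "\<exists>C0. compact C0 \<and> (\<forall>n. AE \<omega> in M. C n \<omega> \<subseteq> C0)"
    \<comment> \<open>The exceptional null set may depend on \<open>n\<close>; countably many of
      them combine into one.\<close>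
    then obtain C0 where C0: "compact C0" "AE \<omega> in M. \<forall>n. C n \<omega> \<subseteq> C0"
      unfolding AE_all_countable by blast
    show "AE \<omega> in M. set_lim (\<lambda>n. convex hull (C n \<omega>)) (convex hull (C_lim \<omega>))"
      using C C0(2) by eventually_elim (simp add: set_lim_convex_hull[OF _ C0(1)])
  qed
qed

end
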